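(* Let $s$ be a twice differentiable real-valued function on $[0,1]$ such that $h(t)=\frac{d^2 s}{dt^2}(t)$ is continuous and square integrable on $[0,1]$, and suppose that $h$ is bounded by a constant $\beta$, i.e. $|h(t)|\le \beta$ for every $t\in[0,1]$. For integers $k\ge 1$, $M\ge 1$ let $$h_{k,M}(t)=\sum_{n=1}^{2^{k-1}}\sum_{m=0}^{M-1}\rho_{n,m}\,\mathcal{W}_{n,m}(t)$$ be the semi-orthogonal Tribonacci wavelet (SOTW) expansion of $h$ at resolution level $k$ and order $M$. Then the SOTW expansion of $h$ converges: $\|h-h_{k,M}\|_{L^2[0,1]}\to 0$ as $k,M\to\infty$.
   Context: Tribonacci polynomials: $T_0(t)=1$, $T_1(t)=t$, $T_2(t)=t^2$, and $T_l(t)=t^2T_{l-1}(t)+t\,T_{l-2}(t)+T_{l-3}(t)$ for $l\ge 3$. Put $z_m=\int_0^1 T_m(t)^2\,dt$ and $\hat T_m(t)=\frac{1}{\sqrt{z_m}}T_m(t)$. Semi-orthogonal Tribonacci wavelets (SOTW): for a resolution level $k\in\{1,2,3,\dots\}$, $n\in\{1,\dots,2^{k-1}\}$ and $m\in\{0,\dots,M-1\}$, $$\mathcal{W}_{n,m}(t)=\begin{cases}2^{\frac{k-1}{2}}\,\hat T_m(2^{k-1}t-n+1), & \frac{n-1}{2^{k-1}}\le t<\frac{n}{2^{k-1}},\\ 0,&\text{otherwise.}\end{cases}$$ (The functions $\mathcal{W}_{n,m}$ depend on $k$, which is suppressed in the notation.) SOTW expansion: for $g\in L^2[0,1]$ and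 fixed $k,M$, let $\mathcal{W}(t)$ be the row vector of length $2^{k-1}M$ with entries $\mathcal{W}_{n,m}(t)$, ordered as $\mathcal{W}_{1,0},\dots,\mathcal{W}_{1,M-1},\mathcal{W}_{2,0},\dots,\mathcal{W}_{2^{k-1},M-1}$. Let $G=[g_{n,m}]$ be the row vector (same ordering) with $g_{n,m}=\int_0^1 g(t)\mathcal{W}_{n,m}(t)\,dt$, and let $D=\int_0^1\mathcal{W}(t)^{\mathsf T}\mathcal{W}(t)\,dt$ be the Gram matrix, of size $2^{k-1}M\times 2^{k-1}M$. The coefficient vector $B=[\rho_{n,m}]$ (same ordering) is $B=GD^{-1}$, and the SOTW expansion of $g$ at level $k$ and order $M$ is $\sum_{n=1}^{2^{k-1}}\sum_{m=0}^{M-1}\rho_{n,m}\mathcal{W}_{n,m}(t)$. In the claim this is applied with $g=h$; the coefficients $\rho_{n,m}$ depend on $k$ and $M$. The limit $k,M\to\infty$ means that both $k$ and $M$ tend to infinity. *)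

theory Defs
  imports "HOL-Analysis.Analysis" "HOL-Computational_Algebra.Polynomial"
    "Jordan_Normal_Form.Gauss_Jordan_Elimination"
begin

fun tribonacci :: "nat \<Rightarrow> real poly" where
  "tribonacci 0 = [:1:]"
| "tribonacci (Suc 0) = [:0, 1:]"
| "tribonacci (Suc (Suc 0)) = [:0, 0, 1:]"
| "tribonacci (Suc (Suc (Suc l))) =
     [:0, 0, 1:] * tribonacci (Suc (Suc l)) + [:0, 1:] * tribonacci (Suc l) + tribonacci l"

definition tribonacci_z :: "nat \<Rightarrow> real" where
  "tribonacci_z m = (LINT t:{0..1}|lborel. (poly (tribonacci m) t)\<^sup>2)"

definition tribonacci_hat :: "nat \<Rightarrow> real \<Rightarrow> real" where
  "tribonacci_hat m t = 1 / sqrt (tribonacci_z m) * poly (tribonacci m) t"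

text \<open>
  The wavelet \<open>W\<^sub>n\<^sub>,\<^sub>m\<close> at resolution level \<open>k\<close>, meant for \<open>k \<ge> 1\<close> and \<open>1 \<le> n \<le> 2 ^ (k - 1)\<close>.
\<close>
definition sotw :: "nat \<Rightarrow> nat \<Rightarrow> nat \<Rightarrow> real \<Rightarrow> real" where
  "sotw k n m t =
     (if (real n - 1) / 2 ^ (k - 1) \<le> t \<and> t < real n / 2 ^ (k - 1)
      then 2 powr ((real k - 1) / 2) * tribonacci_hat m (2 ^ (k - 1) * t - real n + 1)
      else 0)"

text \<open>
  Matrix indices start at 0: the pair \<open>(n, m)\<close> with \<open>1 \<le> n\<close> and \<open>m < M\<close> has position
  \<open>(n - 1) * M + m\<close>, and position \<open>i\<close> belongs to the pair \<open>(i div M + 1, i mod M)\<close>.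
\<close>
definition sotw_at :: "nat \<Rightarrow> nat \<Rightarrow> nat \<Rightarrow> real \<Rightarrow> real" where
  "sotw_at k M i = sotw k (i div M + 1) (i mod M)"

definition sotw_moments :: "nat \<Rightarrow> nat \<Rightarrow> (real \<Rightarrow> real) \<Rightarrow> real mat" where
  "sotw_moments k M g =
     Matrix.mat 1 (2 ^ (k - 1) * M) (\<lambda>(_, j). LINT t:{0..1}|lborel. g t * sotw_at k M j t)"

definition sotw_gram :: "nat \<Rightarrow> nat \<Rightarrow> real mat" where
  "sotw_gram k M =
     Matrix.mat (2 ^ (k - 1) * M) (2 ^ (k - 1) * M)
       (\<lambda>(i, j). LINT t:{0..1}|lborel. sotw_at k M i t * sotw_at k M j t)"

text \<open>
  \<open>mat_inverse\<close> returns \<open>None\<close> exactly on singular matrices. The Gram matrix is never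
  singular, because the Tribonacci polynomials have pairwise distinct degrees.
\<close>
definition sotw_coeff_row :: "nat \<Rightarrow> nat \<Rightarrow> (real \<Rightarrow> real) \<Rightarrow> real mat" where
  "sotw_coeff_row k M g = sotw_moments k M g * the (mat_inverse (sotw_gram k M))"

definition sotw_coeff :: "nat \<Rightarrow> nat \<Rightarrow> (real \<Rightarrow> real) \<Rightarrow> nat \<Rightarrow> nat \<Rightarrow> real" where
  "sotw_coeff k M g n m = sotw_coeff_row k M g $$ (0, (n - 1) * M + m)"

definition sotw_expansion :: "nat \<Rightarrow> nat \<Rightarrow> (real \<Rightarrow> real) \<Rightarrow> real \<Rightarrow> real" where
  "sotw_expansion k M g t =
     (\<Sum>n = 1..2 ^ (k - 1). \<Sum>m<M. sotw_coeff k M g n m * sotw k n m t)"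

text \<open>
  The Bochner integral is 0 for non-integrable functions, so this is the \<open>L\<^sup>2[0,1]\<close> norm only
  for square integrable \<open>f\<close>.
\<close>
definition L2_norm_01 :: "(real \<Rightarrow> real) \<Rightarrow> real" where
  "L2_norm_01 f = sqrt (LINT t:{0..1}|lborel. (f t)\<^sup>2)"

end

theory Submission
  imports Defs "Jordan_Normal_Form.Determinant"
begin

text \<open>
  The matrix formula \<open>B = G D\<^sup>-\<^sup>1\<close> says that the expansion \<open>P\<close> of \<open>h\<close> has the same inner product as
  \<open>h\<close> with every wavelet, so \<open>P\<close> is the orthogonal projection of \<open>h\<close> onto the span of the
  wavelets, and no element of the span is closer to \<open>h\<close> in \<open>L\<^sup>2\<close> than \<open>P\<close> is
  (\<open>sotw_expansion_best_approximation\<close>). As \<open>T\<^sub>0 = 1\<close>, the span contains every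
  function that is constant on the dyadic cells \<open>[p / 2\<^sup>k\<^sup>-\<^sup>1, (p + 1) / 2\<^sup>k\<^sup>-\<^sup>1)\<close>, for
  every \<open>M \<ge> 1\<close>. Comparing \<open>P\<close> with the step function that samples \<open>h\<close> at the left ends of the
  cells bounds the error by the oscillation of \<open>h\<close> on intervals of length \<open>2\<^sup>1\<^sup>-\<^sup>k\<close>, which tends to
  \<open>0\<close> because \<open>h\<close> is uniformly continuous on \<open>[0,1]\<close>
  (\<open>sotw_expansion_error_le_oscillation\<close>).

  The projection argument needs the Gram matrix to be invertible, that is, the wavelets to be linearly
  independent in \<open>L\<^sup>2[0,1]\<close> (\<open>det_sotw_gram_nonzero\<close>). Wavelets of different cells have
  disjoint supports; within one cell they are rescaled Tribonacci polynomials, whose degrees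
  \<open>0, 1, 2, 4, 6, \<dots>\<close> are distinct, and a polynomial that vanishes almost everywhere on an interval
  is zero.
\<close>

section \<open>Linear independence of the Tribonacci polynomials\<close>

lemma degree_tribonacci_Suc_Suc: "degree (tribonacci (Suc (Suc l))) = 2 * l + 2"
proof (induction l rule: less_induct)
  case (less l)
  show ?case
  proof (cases l)
    case 0
    then show ?thesis by (simp add: numeral_2_eq_2)
  next
    case (Suc j)
    have deg: "degree (tribonacci (Suc (Suc j))) = 2 * j + 2"
      using less Suc by simp
    then have nz: "tribonacci (Suc (Suc j)) \<noteq> 0" by (metis add_2_eq_Suc' degree_0 nat.distinct(1))
    have low: "degree (tribonacci (Suc j)) \<le> 2 * j + 1 \<and> degree (tribonacci j) \<le> 2 * j + 1"
    proof (cases j)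
      case (Suc i)
      have "degree (tribonacci (Suc (Suc i))) = 2 * i + 2" using less \<open>l = Suc j\<close> Suc by simp
      moreover have "degree (tribonacci (Suc i)) \<le> 2 * i + 3"
      proof (cases i)
        case (Suc i')
        then show ?thesis using less[of i'] \<open>l = Suc j\<close> \<open>j = Suc i\<close> by simp
      qed simp
      ultimately show ?thesis using Suc by simp
    qed simp
    have lead: "degree ([:0, 0, 1:] * tribonacci (Suc (Suc j))) = 2 * j + 4"
      using nz deg by (subst degree_mult_eq) auto
    have "degree ([:0, 1:] * tribonacci (Suc j)) \<le> 2 * j + 2"
      using degree_mult_le[of "[:0, 1:]" "tribonacci (Suc j)"] low by simp
    then have "degree ([:0, 1:] * tribonacci (Suc j) + tribonacci j) < 2 * j + 4"
      using low by (intro degree_add_less) auto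
    then have "degree ([:0, 0, 1:] * tribonacci (Suc (Suc j)) +
        ([:0, 1:] * tribonacci (Suc j) + tribonacci j)) = 2 * j + 4"
      using lead by (subst degree_add_eq_left) auto
    then show ?thesis using Suc by (simp only: tribonacci.simps add.assoc) simp
  qed
qed

lemma strict_mono_degree_tribonacci: "strict_mono (\<lambda>m. degree (tribonacci m))"
proof (rule strict_mono_Suc_iff[THEN iffD2], intro allI)
  fix m
  show "degree (tribonacci m) < degree (tribonacci (Suc m))"
  proof (cases m)
    case (Suc j)
    then show ?thesis
      by (cases j) (simp_all only: degree_tribonacci_Suc_Suc, simp_all)
  qed simp
qed

lemma tribonacci_nonzero: "tribonacci m \<noteq> 0"
proof (cases m)
  case (Suc j)
  then have "degree (tribonacci m) > 0"
    using strict_monoD[OF strict_mono_degree_tribonacci, of 0 m] by simp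
  then show ?thesis by auto
qed simp

text \<open>The top coefficient of the sum can only come from the last summand.\<close>

lemma poly_family_independent:
  fixes f :: "nat \<Rightarrow> 'a :: idom poly"
  assumes "strict_mono (\<lambda>m. degree (f m))" and "\<And>m. f m \<noteq> 0"
    and "(\<Sum>m<M. Polynomial.smult (c m) (f m)) = 0" and "m < M"
  shows "c m = 0"
  using assms(3,4)
proof (induction M)
  case (Suc M)
  have "Polynomial.coeff (f i) (degree (f M)) = 0" if "i < M" for i
    using strict_monoD[OF assms(1) that] by (rule coeff_eq_0)
  then have "Polynomial.coeff (\<Sum>m<Suc M. Polynomial.smult (c m) (f m)) (degree (f M)) = c M * lead_coeff (f M)"
    by (simp add: coeff_sum)
  then have "c M * lead_coeff (f M) = 0" unfolding Suc.prems(1) by simp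
  then have "c M = 0" using assms(2)[of M] by simp
  then show ?case using Suc by (cases "m = M") auto
qed simp

lemma poly_AE_zero_on_interval:
  fixes p :: "real poly"
  assumes "a < b" and "AE t in lborel. t \<in> {a<..<b} \<longrightarrow> poly p t = 0"
  shows "p = 0"
proof (rule ccontr)
  assume "p \<noteq> 0"
  then have "{t. poly p t = 0} \<in> null_sets lborel"
    by (intro finite_imp_null_set_lborel poly_roots_finite)
  then have "AE t in lborel. poly p t \<noteq> 0" using AE_not_in by fastforce
  with assms(2) have "AE t in lborel. t \<notin> {a<..<b}" by eventually_elim auto
  then have "{a<..<b} \<in> null_sets lborel" by (subst AE_iff_null_sets) auto
  then show False using \<open>a < b\<close> by (simp add: null_sets_def)
qed

section \<open>Bounded measurable functions on the unit interval\<close>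

text \<open>
  A class that contains \<open>h\<close> and the wavelets, is closed under sums and products, and consists of
  integrable functions. Measurability is only asked for on \<open>[0,1]\<close>, as \<open>h\<close> is arbitrary elsewhere.
\<close>

definition bdd_meas_01 :: "(real \<Rightarrow> real) \<Rightarrow> bool" where
  "bdd_meas_01 f \<longleftrightarrow>
     (\<lambda>t. indicator {0..1} t * f t) \<in> borel_measurable lborel \<and> (\<exists>B. \<forall>t\<in>{0..1}. \<bar>f t\<bar> \<le> B)"

lemma bdd_meas_01_mult:
  assumes "bdd_meas_01 f" "bdd_meas_01 g"
  shows "bdd_meas_01 (\<lambda>t. f t * g t)"
proof -
  from assms obtain A B where AB: "\<forall>t\<in>{0..1}. \<bar>f t\<bar> \<le> A" "\<forall>t\<in>{0..1}. \<bar>g t\<bar> \<le> B"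
    unfolding bdd_meas_01_def by blast
  have "\<bar>f t * g t\<bar> \<le> A * B" if "t \<in> {0..1}" for t
    unfolding abs_mult using AB that by (intro mult_mono) (auto intro: order_trans[OF abs_ge_zero])
  moreover have "(\<lambda>t. (indicator {0..1} t * f t) * (indicator {0..1} t * g t)) \<in> borel_measurable lborel"
    using assms[unfolded bdd_meas_01_def, THEN conjunct1] by (rule borel_measurable_times)
  moreover have "(indicator {0..1} t * f t) * (indicator {0..1} t * g t)
      = indicator {0..1} t * (f t * g t)" for t
    by (simp add: indicator_def)
  ultimately show ?thesis unfolding bdd_meas_01_def by (metis (no_types, lifting) ext)
qed

lemma bdd_meas_01_add:
  assumes "bdd_meas_01 f" "bdd_meas_01 g"
  shows "bdd_meas_01 (\<lambda>t. f t + g t)"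
proof -
  from assms obtain A B where AB: "\<forall>t\<in>{0..1}. \<bar>f t\<bar> \<le> A" "\<forall>t\<in>{0..1}. \<bar>g t\<bar> \<le> B"
    unfolding bdd_meas_01_def by blast
  have "\<bar>f t + g t\<bar> \<le> A + B" if "t \<in> {0..1}" for t
    using AB that by (intro order_trans[OF abs_triangle_ineq] add_mono) auto
  moreover have "(\<lambda>t. indicator {0..1} t * f t + indicator {0..1} t * g t) \<in> borel_measurable lborel"
    using assms[unfolded bdd_meas_01_def, THEN conjunct1] by (rule borel_measurable_add)
  ultimately show ?thesis unfolding bdd_meas_01_def distrib_left by blast
qed

lemma bdd_meas_01_continuous:
  assumes "continuous_on {0..1} f"
  shows "bdd_meas_01 f"
proof -
  have "compact (f ` {0..1})" using assms by (intro compact_continuous_image) auto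
  then obtain B where "\<forall>x\<in>f ` {0..1}. norm x \<le> B"
    using compact_imp_bounded bounded_iff by blast
  moreover have "(\<lambda>t. indicator {0..1} t *\<^sub>R f t) \<in> borel_measurable borel"
    using assms by (intro borel_measurable_continuous_on_indicator) auto
  ultimately show ?thesis unfolding bdd_meas_01_def by auto
qed

lemma bdd_meas_01_const: "bdd_meas_01 (\<lambda>_. c)"
  by (intro bdd_meas_01_continuous continuous_intros)

lemma bdd_meas_01_diff:
  assumes "bdd_meas_01 f" "bdd_meas_01 g"
  shows "bdd_meas_01 (\<lambda>t. f t - g t)"
  using bdd_meas_01_add[OF assms(1) bdd_meas_01_mult[OF bdd_meas_01_const[of "-1"] assms(2)]] by simp

lemma bdd_meas_01_sum:
  assumes "\<And>i. i \<in> I \<Longrightarrow> bdd_meas_01 (f i)"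
  shows "bdd_meas_01 (\<lambda>t. \<Sum>i\<in>I. f i t)"
  using assms
  by (induction I rule: infinite_finite_induct) (simp_all add: bdd_meas_01_const bdd_meas_01_add)

lemma bdd_meas_01_integrable:
  assumes "bdd_meas_01 f"
  shows "set_integrable lborel {0..1} f"
proof -
  obtain B where B: "\<forall>t\<in>{0..1}. \<bar>f t\<bar> \<le> B" using assms unfolding bdd_meas_01_def by blast
  have "integrable lborel (\<lambda>t. indicator {0..1} t * f t)"
    using assms B unfolding bdd_meas_01_def
    by (intro integrableI_bounded_set[where A = "{0..1}" and B = B]) (auto simp: indicator_def)
  then show ?thesis unfolding set_integrable_def by simp
qed

lemma AE_zero_if_integral_square_zero:
  assumes "bdd_meas_01 f" and "(LINT t:{0..1}|lborel. (f t)\<^sup>2) = 0"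
  shows "AE t in lborel. t \<in> {0..1} \<longrightarrow> f t = 0"
proof -
  have "set_integrable lborel {0..1} (\<lambda>t. (f t)\<^sup>2)"
    using bdd_meas_01_integrable[OF bdd_meas_01_mult[OF assms(1,1)]] by (simp add: power2_eq_square)
  then have "AE t in lborel. indicator {0..1} t *\<^sub>R (f t)\<^sup>2 = 0"
    using assms(2) integral_nonneg_eq_0_iff_AE[of lborel "\<lambda>t. indicator {0..1} t *\<^sub>R (f t)\<^sup>2"]
    unfolding set_integrable_def set_lebesgue_integral_def by simp
  then show ?thesis by eventually_elim (auto simp: indicator_def)
qed

lemma integral_mult_sum_left:
  assumes "bdd_meas_01 g" and "\<And>i. i \<in> I \<Longrightarrow> bdd_meas_01 (W i)"
  shows "(LINT t:{0..1}|lborel. (\<Sum>i\<in>I. c i * W i t) * g t)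
    = (\<Sum>i\<in>I. c i * (LINT t:{0..1}|lborel. W i t * g t))"
proof -
  have "(LINT t:{0..1}|lborel. (\<Sum>i\<in>I. c i * W i t) * g t)
      = (LINT t:{0..1}|lborel. (\<Sum>i\<in>I. c i * (W i t * g t)))"
    by (simp add: sum_distrib_right mult.assoc)
  also have "\<dots> = (\<Sum>i\<in>I. LINT t:{0..1}|lborel. c i * (W i t * g t))"
  proof -
    have "integrable lborel (\<lambda>t. indicator {0..1} t *\<^sub>R (c i * (W i t * g t)))" if "i \<in> I" for i
      using bdd_meas_01_integrable[OF bdd_meas_01_mult[OF bdd_meas_01_const
          bdd_meas_01_mult[OF assms(2)[OF that] assms(1)]]]
      unfolding set_integrable_def .
    then show ?thesis
      unfolding set_lebesgue_integral_def scaleR_sum_right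
      by (intro Bochner_Integration.integral_sum)
  qed
  finally show ?thesis by simp
qed

text \<open>
  The normal equations make the residual of \<open>\<Sum> c\<^sub>i W\<^sub>i\<close> orthogonal to the span of the
  \<open>W\<^sub>i\<close>, so by Pythagoras no other combination does better.
\<close>

lemma normal_equations_minimize:
  assumes h: "bdd_meas_01 h" and W: "\<And>i. i \<in> I \<Longrightarrow> bdd_meas_01 (W i)"
    and normal: "\<And>j. j \<in> I \<Longrightarrow>
      (\<Sum>i\<in>I. c i * (LINT t:{0..1}|lborel. W i t * W j t)) = (LINT t:{0..1}|lborel. h t * W j t)"
  shows "(LINT t:{0..1}|lborel. (h t - (\<Sum>i\<in>I. c i * W i t))\<^sup>2)
    \<le> (LINT t:{0..1}|lborel. (h t - (\<Sum>i\<in>I. b i * W i t))\<^sup>2)"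
proof -
  define e where "e = (\<lambda>t. h t - (\<Sum>i\<in>I. c i * W i t))"
  define r where "r = (\<lambda>t. \<Sum>i\<in>I. (c i - b i) * W i t)"
  have comb: "bdd_meas_01 (\<lambda>t. \<Sum>i\<in>I. a i * W i t)" for a
    using W by (intro bdd_meas_01_sum bdd_meas_01_mult bdd_meas_01_const)
  have e: "bdd_meas_01 e" unfolding e_def using h comb by (intro bdd_meas_01_diff)
  have r: "bdd_meas_01 r" unfolding r_def by (rule comb)
  have "(LINT t:{0..1}|lborel. W j t * e t) = 0" if j: "j \<in> I" for j
  proof -
    have "(LINT t:{0..1}|lborel. W j t * e t)
        = (LINT t:{0..1}|lborel. h t * W j t - (\<Sum>i\<in>I. c i * W i t) * W j t)"
      unfolding e_def by (simp add: algebra_simps)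
    also have "\<dots> = (LINT t:{0..1}|lborel. h t * W j t)
        - (LINT t:{0..1}|lborel. (\<Sum>i\<in>I. c i * W i t) * W j t)"
      using h comb W[OF j] by (intro set_integral_diff(2) bdd_meas_01_integrable bdd_meas_01_mult)
    also have "\<dots> = 0" using normal[OF j] W j by (simp add: integral_mult_sum_left)
    finally show ?thesis .
  qed
  then have orth: "(LINT t:{0..1}|lborel. r t * e t) = 0"
    unfolding r_def using W e by (simp add: integral_mult_sum_left)
  have split: "(h t - (\<Sum>i\<in>I. b i * W i t))\<^sup>2 = (e t * e t + 2 * (r t * e t)) + r t * r t" for t
  proof -
    have "h t - (\<Sum>i\<in>I. b i * W i t) = e t + r t"
      unfolding e_def r_def by (simp add: left_diff_distrib sum_subtractf)
    then show ?thesis by (simp add: power2_eq_square algebra_simps)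
  qed
  have int: "set_integrable lborel {0..1} (\<lambda>t. e t * e t)"
    "set_integrable lborel {0..1} (\<lambda>t. 2 * (r t * e t))"
    "set_integrable lborel {0..1} (\<lambda>t. r t * r t)"
    using e r by (auto intro!: bdd_meas_01_integrable bdd_meas_01_mult bdd_meas_01_const)
  have "(LINT t:{0..1}|lborel. (h t - (\<Sum>i\<in>I. b i * W i t))\<^sup>2)
      = (LINT t:{0..1}|lborel. e t * e t) + (LINT t:{0..1}|lborel. 2 * (r t * e t))
        + (LINT t:{0..1}|lborel. r t * r t)"
    unfolding split using int by (simp add: set_integral_add)
  moreover have "(LINT t:{0..1}|lborel. r t * r t) \<ge> 0"
    unfolding set_lebesgue_integral_def by (intro integral_nonneg_AE) simp
  ultimately show ?thesis using orth by (simp add: e_def power2_eq_square)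
qed

section \<open>The wavelets on a dyadic cell\<close>

lemma tribonacci_z_pos: "tribonacci_z m > 0"
proof -
  have cont: "continuous_on {0..1} (poly (tribonacci m))" by (intro continuous_intros)
  have "tribonacci_z m \<noteq> 0"
  proof
    assume "tribonacci_z m = 0"
    then have "AE t in lborel. t \<in> {0..1} \<longrightarrow> poly (tribonacci m) t = 0"
      unfolding tribonacci_z_def
      by (intro AE_zero_if_integral_square_zero bdd_meas_01_continuous cont)
    then have "AE t in lborel. t \<in> {0<..<1} \<longrightarrow> poly (tribonacci m) t = 0"
      by eventually_elim auto
    then show False using poly_AE_zero_on_interval[of 0 1] tribonacci_nonzero by auto
  qed
  moreover have "tribonacci_z m \<ge> 0"
    unfolding tribonacci_z_def set_lebesgue_integral_def by (intro integral_nonneg_AE) simp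
  ultimately show ?thesis by simp
qed

lemma tribonacci_hat_0: "tribonacci_hat 0 t = 1"
proof -
  have "tribonacci_z 0 = 1"
    unfolding tribonacci_z_def set_lebesgue_integral_def by simp
  then show ?thesis unfolding tribonacci_hat_def by simp
qed

lemma bdd_meas_01_sotw: "bdd_meas_01 (sotw k n m)"
proof -
  let ?I = "{(real n - 1) / 2 ^ (k - 1)..<real n / 2 ^ (k - 1)}"
  let ?g = "\<lambda>t. 2 powr ((real k - 1) / 2) * tribonacci_hat m (2 ^ (k - 1) * t - real n + 1)"
  have "bdd_meas_01 ?g"
    unfolding tribonacci_hat_def by (intro bdd_meas_01_continuous continuous_intros)
  moreover have "bdd_meas_01 (indicat_real ?I)"
    unfolding bdd_meas_01_def by (auto intro!: exI[of _ 1] simp: indicator_def)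
  ultimately have "bdd_meas_01 (\<lambda>t. indicat_real ?I t * ?g t)" by (rule bdd_meas_01_mult[rotated])
  moreover have "sotw k n m = (\<lambda>t. indicat_real ?I t * ?g t)"
    unfolding sotw_def by (auto simp: indicator_def)
  ultimately show ?thesis by simp
qed

lemma bdd_meas_01_sotw_at: "bdd_meas_01 (sotw_at k M i)"
  unfolding sotw_at_def by (rule bdd_meas_01_sotw)

lemma sotw_on_cell:
  assumes "real q \<le> 2 ^ (k - 1) * t" "2 ^ (k - 1) * t < real q + 1"
  shows "sotw k (Suc p) m t =
    (if p = q then 2 powr ((real k - 1) / 2) * tribonacci_hat m (2 ^ (k - 1) * t - real q) else 0)"
proof -
  have "(real (Suc p) - 1) / 2 ^ (k - 1) \<le> t \<and> t < real (Suc p) / 2 ^ (k - 1)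
      \<longleftrightarrow> real p \<le> 2 ^ (k - 1) * t \<and> 2 ^ (k - 1) * t < real p + 1"
    by (simp add: field_simps)
  also have "\<dots> \<longleftrightarrow> p = q" using assms by auto
  finally show ?thesis unfolding sotw_def by (auto simp: algebra_simps)
qed

lemma sum_lessThan_mult_blocks:
  fixes f :: "nat \<Rightarrow> 'a :: comm_monoid_add"
  shows "(\<Sum>i<K * M. f i) = (\<Sum>p<K. \<Sum>m<M. f (p * M + m))"
proof -
  have "(\<Sum>m<M. f (p * M + m)) = sum f {p * M..<p * M + M}" for p
    using sum.shift_bounds_nat_ivl[of f 0 "p * M" M]
    by (simp add: atLeast0LessThan add.commute)
  then show ?thesis by (simp add: sum.nat_group)
qed

lemma sotw_at_sum_blocks:
  "(\<Sum>i<K * M. c i * sotw_at k M i t) = (\<Sum>p<K. \<Sum>m<M. c (p * M + m) * sotw k (Suc p) m t)"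
  unfolding sum_lessThan_mult_blocks sotw_at_def by (intro sum.cong) auto

lemma sotw_at_sum_on_cell:
  assumes "q < K" "real q \<le> 2 ^ (k - 1) * t" "2 ^ (k - 1) * t < real q + 1"
  shows "(\<Sum>i<K * M. c i * sotw_at k M i t) =
    2 powr ((real k - 1) / 2) * (\<Sum>m<M. c (q * M + m) * tribonacci_hat m (2 ^ (k - 1) * t - real q))"
proof -
  have "(\<Sum>i<K * M. c i * sotw_at k M i t) = (\<Sum>p<K. if p = q then
      (\<Sum>m<M. c (q * M + m) * (2 powr ((real k - 1) / 2) *
        tribonacci_hat m (2 ^ (k - 1) * t - real q))) else 0)"
    unfolding sotw_at_sum_blocks sotw_on_cell[OF assms(2,3)] by (intro sum.cong) auto
  also have "\<dots> = 2 powr ((real k - 1) / 2) *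
      (\<Sum>m<M. c (q * M + m) * tribonacci_hat m (2 ^ (k - 1) * t - real q))"
    using assms(1) by (simp add: sum_distrib_left mult.left_commute)
  finally show ?thesis .
qed

section \<open>Invertibility of the Gram matrix\<close>

text \<open>
  On the cell of index \<open>i div M\<close> the sum is a combination of Tribonacci polynomials in
  the local variable \<open>2\<^sup>k\<^sup>-\<^sup>1 t - i div M\<close>.
\<close>

lemma sotw_at_independent:
  assumes ae: "AE t in lborel. t \<in> {0..1} \<longrightarrow> (\<Sum>i<2 ^ (k - 1) * M. c i * sotw_at k M i t) = 0"
    and i: "i < 2 ^ (k - 1) * M"
  shows "c i = 0"
proof -
  define K :: nat where "K = 2 ^ (k - 1)"
  have K: "K > 0" and realK: "real K = 2 ^ (k - 1)" unfolding K_def by simp_all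
  define q m where "q = i div M" and "m = i mod M"
  have "M > 0" using i by (cases M) auto
  then have m: "m < M" and im: "i = q * M + m" unfolding q_def m_def by simp_all
  have q: "q < K" using i unfolding q_def K_def by (simp add: less_mult_imp_div_less)
  define p where "p = (\<Sum>m<M. Polynomial.smult (c (q * M + m) / sqrt (tribonacci_z m)) (tribonacci m))"
  define l where "l = [:- real q, real K:]"
  have "poly (pcompose p l) t = 0"
    if t: "t \<in> {real q / K<..<(real q + 1) / K}"
      and 0: "t \<in> {0..1} \<longrightarrow> (\<Sum>i<2 ^ (k - 1) * M. c i * sotw_at k M i t) = 0" for t
  proof -
    have cell: "real q \<le> 2 ^ (k - 1) * t" "2 ^ (k - 1) * t < real q + 1"
      using t K unfolding realK[symmetric] by (auto simp: field_simps)
    have "0 \<le> real q / K" by simp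
    then have "0 \<le> t" using t by (auto simp del: divide_nonneg_nonneg)
    moreover have "t \<le> 1"
    proof -
      have "(real q + 1) / K \<le> 1" using q K by (simp add: field_simps)
      then show ?thesis using t by simp
    qed
    ultimately have "(\<Sum>m<M. c (q * M + m) * tribonacci_hat m (2 ^ (k - 1) * t - real q)) = 0"
      using 0 sotw_at_sum_on_cell[OF q cell, of c M] unfolding K_def by simp
    then show ?thesis
      by (simp add: p_def l_def poly_pcompose poly_sum tribonacci_hat_def realK algebra_simps)
  qed
  with ae have "AE t in lborel. t \<in> {real q / K<..<(real q + 1) / K} \<longrightarrow> poly (pcompose p l) t = 0"
    by (auto elim: eventually_mono)
  then have "pcompose p l = 0"
    by (rule poly_AE_zero_on_interval[rotated]) (use K in \<open>simp add: divide_strict_right_mono\<close>)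
  then have "p = 0" by (rule pcompose_eq_0) (use K in \<open>simp add: l_def\<close>)
  then have "c (q * M + m) / sqrt (tribonacci_z m) = 0"
    unfolding p_def using m
    by (rule poly_family_independent[OF strict_mono_degree_tribonacci tribonacci_nonzero])
  then show ?thesis using tribonacci_z_pos[of m] im by simp
qed

text \<open>
  A kernel vector \<open>v\<close> of the Gram matrix has \<open>v\<^sup>T D v = 0\<close>, and this number is the integral of the
  square of the combination of wavelets with coefficients \<open>v\<close>.
\<close>

lemma det_sotw_gram_nonzero: "det (sotw_gram k M) \<noteq> 0"
proof
  define N where "N = 2 ^ (k - 1) * M"
  have D: "sotw_gram k M \<in> carrier_mat N N" unfolding sotw_gram_def N_def by simp
  assume "det (sotw_gram k M) = 0"
  then obtain v where v: "v \<in> carrier_vec N" "v \<noteq> 0\<^sub>v N" and Dv: "sotw_gram k M *\<^sub>v v = 0\<^sub>v N"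
    using det_0_iff_vec_prod_zero_field[OF D] by blast
  define S where "S = (\<lambda>t. \<Sum>i<N. vec_index v i * sotw_at k M i t)"
  have S: "bdd_meas_01 S"
    unfolding S_def by (intro bdd_meas_01_sum bdd_meas_01_mult bdd_meas_01_const bdd_meas_01_sotw_at)
  have "(LINT t:{0..1}|lborel. sotw_at k M j t * S t) = 0" if j: "j < N" for j
  proof -
    have "(LINT t:{0..1}|lborel. sotw_at k M j t * S t)
        = (\<Sum>i<N. vec_index v i * (LINT t:{0..1}|lborel. sotw_at k M i t * sotw_at k M j t))"
      using integral_mult_sum_left[of "sotw_at k M j" "{..<N}" "sotw_at k M" "vec_index v"]
      unfolding S_def by (simp add: bdd_meas_01_sotw_at mult.commute)
    also have "\<dots> = vec_index (sotw_gram k M *\<^sub>v v) j"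
      using j v(1) unfolding N_def
      by (simp add: sotw_gram_def scalar_prod_def atLeast0LessThan mult.commute)
    also have "\<dots> = 0" using Dv j by simp
    finally show ?thesis .
  qed
  then have "(LINT t:{0..1}|lborel. S t * S t) = 0"
    using integral_mult_sum_left[of S "{..<N}" "sotw_at k M" "vec_index v"] S
    by (simp add: bdd_meas_01_sotw_at S_def[THEN fun_cong, symmetric])
  then have "AE t in lborel. t \<in> {0..1} \<longrightarrow> S t = 0"
    using S by (intro AE_zero_if_integral_square_zero) (simp_all add: power2_eq_square)
  then have "vec_index v i = 0" if "i < N" for i
    using sotw_at_independent that unfolding S_def N_def by blast
  then have "v = 0\<^sub>v N" using v(1) by (intro eq_vecI) auto
  with v(2) show False by simp
qed

section \<open>The expansion as a best approximation\<close>

lemma sotw_expansion_eq_sum: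
  "sotw_expansion k M g t =
    (\<Sum>i<2 ^ (k - 1) * M. sotw_coeff_row k M g $$ (0, i) * sotw_at k M i t)"
  unfolding sotw_expansion_def sotw_at_sum_blocks sotw_coeff_def
  by (simp add: sum.atLeast1_atMost_eq)

lemma sotw_coeff_row_normal_equations:
  assumes "j < 2 ^ (k - 1) * M"
  shows "(\<Sum>i<2 ^ (k - 1) * M. sotw_coeff_row k M g $$ (0, i) *
      (LINT t:{0..1}|lborel. sotw_at k M i t * sotw_at k M j t))
    = (LINT t:{0..1}|lborel. g t * sotw_at k M j t)"
proof -
  define N where "N = 2 ^ (k - 1) * M"
  define D where "D = sotw_gram k M"
  have D: "D \<in> carrier_mat N N" unfolding D_def sotw_gram_def N_def by simp
  have G: "sotw_moments k M g \<in> carrier_mat 1 N" unfolding sotw_moments_def N_def by simp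
  have "D \<in> Units (ring_mat TYPE(real) N ())"
    by (rule det_non_zero_imp_unit[OF D]) (simp add: D_def det_sotw_gram_nonzero)
  then obtain B where B: "mat_inverse D = Some B"
    using mat_inverse(1)[OF D, where b = "()"] by (cases "mat_inverse D") auto
  from mat_inverse(2)[OF D B] have BD: "B * D = 1\<^sub>m N" and Bc: "B \<in> carrier_mat N N" by auto
  have row: "sotw_coeff_row k M g = sotw_moments k M g * B"
    unfolding sotw_coeff_row_def D_def[symmetric] B by simp
  from row have C: "sotw_coeff_row k M g \<in> carrier_mat 1 N" using G Bc by simp
  have "sotw_coeff_row k M g * D = sotw_moments k M g"
    unfolding row using assoc_mult_mat[OF G Bc D] BD G by simp
  moreover have "(sotw_coeff_row k M g * D) $$ (0, j)
      = (\<Sum>i<N. sotw_coeff_row k M g $$ (0, i) * D $$ (i, j))"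
    using assms C D unfolding N_def[symmetric]
    by (simp add: scalar_prod_def atLeast0LessThan)
  ultimately show ?thesis
    using assms unfolding D_def sotw_gram_def sotw_moments_def N_def by simp
qed

lemma sotw_expansion_best_approximation:
  assumes "bdd_meas_01 h"
  shows "L2_norm_01 (\<lambda>t. h t - sotw_expansion k M h t)
    \<le> L2_norm_01 (\<lambda>t. h t - (\<Sum>i<2 ^ (k - 1) * M. b i * sotw_at k M i t))"
  unfolding L2_norm_01_def sotw_expansion_eq_sum
  using normal_equations_minimize[OF assms bdd_meas_01_sotw_at, where I = "{..<2 ^ (k - 1) * M}"]
    sotw_coeff_row_normal_equations
  by (intro real_sqrt_le_mono) simp

text \<open>
  The competitor is the step function with the value \<open>h (q / 2\<^sup>k\<^sup>-\<^sup>1)\<close> on the cell of index \<open>q\<close>. It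
  vanishes at \<open>t = 1\<close>, which no cell contains, so the pointwise bound holds only almost everywhere.
\<close>

lemma sotw_expansion_error_le_oscillation:
  assumes h: "continuous_on {0..1} h" and M: "M > 0" and "\<epsilon> \<ge> 0"
    and osc: "\<And>x y. x \<in> {0..1} \<Longrightarrow> y \<in> {0..1} \<Longrightarrow> \<bar>x - y\<bar> \<le> 1 / 2 ^ (k - 1) \<Longrightarrow> \<bar>h x - h y\<bar> \<le> \<epsilon>"
  shows "L2_norm_01 (\<lambda>t. h t - sotw_expansion k M h t) \<le> \<epsilon>"
proof -
  define K :: nat where "K = 2 ^ (k - 1)"
  have K: "K > 0" and realK: "real K = 2 ^ (k - 1)" unfolding K_def by simp_all
  define b where "b = (\<lambda>i. if i mod M = 0
    then h (real (i div M) / real K) / 2 powr ((real k - 1) / 2) else 0)"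
  define f where "f = (\<lambda>t. h t - (\<Sum>i<K * M. b i * sotw_at k M i t))"
  have bdd_h: "bdd_meas_01 h" using h by (rule bdd_meas_01_continuous)
  have f: "bdd_meas_01 f"
    unfolding f_def using bdd_h
    by (intro bdd_meas_01_diff bdd_meas_01_sum bdd_meas_01_mult bdd_meas_01_const bdd_meas_01_sotw_at)
  have bound: "\<bar>f t\<bar> \<le> \<epsilon>" if t: "0 \<le> t" "t < 1" for t
  proof -
    define q where "q = nat \<lfloor>real K * t\<rfloor>"
    have "real q = of_int \<lfloor>real K * t\<rfloor>" unfolding q_def using t by simp
    then have cell: "real q \<le> real K * t" "real K * t < real q + 1" by linarith+
    have "real K * t < real K" using t K by simp
    then have q: "q < K" using cell(1) by linarith
    have "(\<Sum>m<M. b (q * M + m) * tribonacci_hat m (2 ^ (k - 1) * t - real q))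
        = (\<Sum>m<M. if m = 0 then b (q * M) else 0)"
      by (intro sum.cong) (auto simp: b_def tribonacci_hat_0)
    also have "\<dots> = h (real q / real K) / 2 powr ((real k - 1) / 2)"
      using M by (simp add: b_def)
    finally have "(\<Sum>i<K * M. b i * sotw_at k M i t) = h (real q / real K)"
      using sotw_at_sum_on_cell[OF q, of k t b M] cell unfolding realK by simp
    then have "f t = h t - h (real q / real K)" unfolding f_def by simp
    moreover have "real q / real K \<in> {0..1}" using q by simp
    moreover have "\<bar>t - real q / real K\<bar> \<le> 1 / 2 ^ (k - 1)"
    proof -
      have "t - real q / real K = (real K * t - real q) / real K" using K by (simp add: field_simps)
      then show ?thesis
        using cell K unfolding realK[symmetric] by (simp add: divide_right_mono)
    qed
    ultimately show ?thesis using osc[of t "real q / real K"] t by simp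
  qed
  have "(LINT t:{0..1}|lborel. (f t)\<^sup>2) \<le> (LINT t::real:{0..1}|lborel. \<epsilon>\<^sup>2)"
  proof (rule set_integral_mono_AE)
    show "set_integrable lborel {0..1} (\<lambda>t. (f t)\<^sup>2)"
      using bdd_meas_01_integrable[OF bdd_meas_01_mult[OF f f]] by (simp add: power2_eq_square)
    show "set_integrable lborel {0..1} (\<lambda>t::real. \<epsilon>\<^sup>2)"
      by (intro bdd_meas_01_integrable bdd_meas_01_const)
    show "AE t\<in>{0..1} in lborel. (f t)\<^sup>2 \<le> \<epsilon>\<^sup>2"
      using AE_lborel_singleton[of "1::real"]
    proof eventually_elim
      case (elim t)
      show ?case
      proof
        assume "t \<in> {0..1}"
        then have "\<bar>f t\<bar> \<le> \<epsilon>" using elim bound by auto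
        then show "(f t)\<^sup>2 \<le> \<epsilon>\<^sup>2" by (metis abs_ge_zero power2_abs power_mono)
      qed
    qed
  qed
  also have "\<dots> = \<epsilon>\<^sup>2" unfolding set_lebesgue_integral_def by simp
  finally have "L2_norm_01 f \<le> \<epsilon>"
    unfolding L2_norm_01_def using \<open>\<epsilon> \<ge> 0\<close> by (intro real_le_lsqrt) auto
  then show ?thesis
    using sotw_expansion_best_approximation[OF bdd_h, of k M b] unfolding f_def K_def by simp
qed

section \<open>Convergence\<close>

theorem theorem4p2:
  fixes s s' h :: "real \<Rightarrow> real" and \<beta> :: real
  assumes "\<And>t. t \<in> {0..1} \<Longrightarrow> (s has_real_derivative s' t) (at t within {0..1})"
    and "\<And>t. t \<in> {0..1} \<Longrightarrow> (s' has_real_derivative h t) (at t within {0..1})"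
    and "continuous_on {0..1} h"
    and "set_integrable lborel {0..1} (\<lambda>t. (h t)\<^sup>2)"
    and "\<And>t. t \<in> {0..1} \<Longrightarrow> \<bar>h t\<bar> \<le> \<beta>"
  shows "((\<lambda>(k, M). L2_norm_01 (\<lambda>t. h t - sotw_expansion k M h t)) \<longlongrightarrow> 0)
           (sequentially \<times>\<^sub>F sequentially)"
proof (rule tendstoI)
  fix \<epsilon> :: real
  assume "\<epsilon> > 0"
  have "uniformly_continuous_on {0..1} h"
    using assms(3) by (intro compact_uniformly_continuous) auto
  then obtain \<delta> where "\<delta> > 0" and
    \<delta>: "\<And>x y. x \<in> {0..1} \<Longrightarrow> y \<in> {0..1} \<Longrightarrow> \<bar>x - y\<bar> < \<delta> \<Longrightarrow> \<bar>h x - h y\<bar> < \<epsilon> / 2"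
    using \<open>\<epsilon> > 0\<close> unfolding uniformly_continuous_on_def dist_real_def
    by (metis abs_minus_commute half_gt_zero)
  obtain n where n: "(1 / 2) ^ n < \<delta>"
    using real_arch_pow_inv[OF \<open>\<delta> > 0\<close>, of "1 / 2"] by auto
  \<comment> \<open>\<open>Suc\<close> makes the cell length \<open>2\<^sup>1\<^sup>-\<^sup>k\<close> at most \<open>2\<^sup>-\<^sup>n\<close>, and \<open>M\<close> positive.\<close>
  have "L2_norm_01 (\<lambda>t. h t - sotw_expansion k M h t) \<le> \<epsilon> / 2" if "k \<ge> Suc n" "M \<ge> Suc n" for k M
  proof (rule sotw_expansion_error_le_oscillation[OF assms(3)])
    fix x y :: real
    assume xy: "x \<in> {0..1}" "y \<in> {0..1}" and "\<bar>x - y\<bar> \<le> 1 / 2 ^ (k - 1)"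
    moreover have "(1 / 2 :: real) ^ (k - 1) \<le> (1 / 2) ^ n"
      using that by (intro power_decreasing) auto
    ultimately have "\<bar>x - y\<bar> < \<delta>" using n by (simp add: power_one_over)
    then show "\<bar>h x - h y\<bar> \<le> \<epsilon> / 2" using \<delta> xy by (simp add: less_imp_le)
  qed (use that \<open>\<epsilon> > 0\<close> in auto)
  moreover have "L2_norm_01 f \<ge> 0" for f
    unfolding L2_norm_01_def set_lebesgue_integral_def by (simp add: integral_nonneg_AE)
  ultimately show "\<forall>\<^sub>F p in sequentially \<times>\<^sub>F sequentially.
      dist (case p of (k, M) \<Rightarrow> L2_norm_01 (\<lambda>t. h t - sotw_expansion k M h t)) 0 < \<epsilon>"
    unfolding eventually_prod_sequentially using \<open>\<epsilon> > 0\<close>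
    by (intro exI[of _ "Suc n"]) (force simp: dist_real_def)
qed

end
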